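(* Let $f:\mathbb{R}^d\to\mathbb{R}$ be differentiable and $L$-smooth (possibly nonconvex), attaining its minimum. Let $(x_t)_{t\ge 1}$ be generated by AdaGrad with exact (deterministic) gradients and with $G_0=0$: starting from $x_1\in\mathbb{R}^d$, $$x_{t+1}=x_t-\eta_t\nabla f(x_t),\qquad \eta_t=\frac{1}{\sqrt{\sum_{k=1}^{t}\|\nabla f(x_k)\|^2}} .$$ Let $\Delta_1=f(x_1)-\min_{x\in\mathbb{R}^d}f(x)$. Then it holds that $$\frac1T\sum_{t=1}^{T}\|\nabla f(x_t)\|^2\le O\!\left(\frac{(\Delta_1+L)^2}{T}\right).$$
   Context: $\|\cdot\|$ is the Euclidean norm. $f$ is $L$-smooth if $\|\nabla f(x)-\nabla f(y)\|\le L\|x-y\|$ for all $x,y\in\mathbb{R}^d$. $T$ is the number of iterations. AdaGrad with parameter $G_0$ uses the scalar step-size $\eta_t=1/\sqrt{G_0^2+\sum_{k=1}^t\|g_k\|^2}$, where $g_k$ is the gradient used at step $k$; here $G_0=0$ and $g_k=\nabla f(x_k)$. If $\sum_{k\le t}\|\nabla f(x_k)\|^2=0$ the step is taken to be zero, i.e. $x_{t+1}=x_t$.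
   Formalization: The constant in O(.) is not absolute: it is 4(1+ln max(1, L/||∇f(x_1)||))^2 for every T≥1, since with G_0=0 no absolute constant works (a tiny first gradient lets f rise by order L ln(L/||∇f(x_1)||)); the O-statement in T is proved for each instance. *)

theory Defs
  imports "HOL-Analysis.Analysis" "HOL-Library.Landau_Symbols"
begin

text \<open>The sequences are indexed from 1. Since \<open>1 / 0 = 0\<close>, the step-size, and hence the step, is
  zero as long as \<open>G0 = 0\<close> and all the gradients seen so far vanish.\<close>

definition adagrad_stepsize :: "real \<Rightarrow> (nat \<Rightarrow> 'a::real_normed_vector) \<Rightarrow> nat \<Rightarrow> real" where
  "adagrad_stepsize G0 g t = 1 / sqrt (G0\<^sup>2 + (\<Sum>k=1..t. (norm (g k))\<^sup>2))"

definition adagrad_iterates :: "real \<Rightarrow> ('a::real_normed_vector \<Rightarrow> 'a) \<Rightarrow> (nat \<Rightarrow> 'a) \<Rightarrow> bool" where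
  "adagrad_iterates G0 grad x \<longleftrightarrow>
     (\<forall>t\<ge>1. x (t + 1) = x t - adagrad_stepsize G0 (\<lambda>k. grad (x k)) t *\<^sub>R grad (x t))"

text \<open>The constant hidden in the \<open>O\<close> of the convergence rate, as a function of
  \<open>r = L / norm (grad (x 1))\<close>; it is 4 for \<open>r \<le> 1\<close>. With \<open>G0 = 0\<close> no number works
  for all \<open>r\<close>: while the accumulated squared gradient norms are below \<open>L\<^sup>2\<close>, the value of \<open>f\<close> can
  rise by a fixed multiple of \<open>L\<close> in each step, which allows a total rise of order \<open>L * ln r\<close>.\<close>

definition rate_constant :: "real \<Rightarrow> real" where
  "rate_constant r = 4 * (1 + ln (max 1 r))\<^sup>2"

end

theory Submission imports Defs begin

text \<open>Write \<open>b\<^sub>t\<close> for the root of the accumulated squared gradient norms. By the descent lemma,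
  \<open>f (x\<^sub>t\<^sub>+\<^sub>1) - f (x\<^sub>t)\<close> is at most \<open>- \<parallel>g\<^sub>t\<parallel>\<^sup>2 / b\<^sub>t + (L / 2) \<parallel>g\<^sub>t\<parallel>\<^sup>2 / b\<^sub>t\<^sup>2\<close>, and the first term is at most
  \<open>- (b\<^sub>t - b\<^sub>t\<^sub>-\<^sub>1)\<close>. Once \<open>b\<^sub>t \<ge> L\<close>, half of the first term absorbs the second. Before that,
  \<open>\<parallel>g\<^sub>t\<parallel>\<^sup>2 / b\<^sub>t\<^sup>2 \<le> 2 (ln b\<^sub>t - ln b\<^sub>t\<^sub>-\<^sub>1)\<close>, so the total rise is logarithmic in \<open>L / b\<^sub>1\<close>. Summing bounds
  \<open>b\<^sub>T\<close> by \<open>2 \<Delta>\<^sub>1 + L (1 + 2 ln (max 1 (L / b\<^sub>1)))\<close>.\<close>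

lemma smooth_descent:
  fixes f :: "'a::real_inner \<Rightarrow> real"
  assumes gradient: "\<And>y. GDERIV f y :> grad y"
    and smooth: "\<And>y z. norm (grad y - grad z) \<le> L * norm (y - z)"
  shows "f (y + d) \<le> f y + grad y \<bullet> d + L / 2 * (norm d)\<^sup>2"
proof -
  \<comment> \<open>\<open>h\<close> is \<open>f\<close> along the segment minus its linear part and
    the claimed quadratic excess. Cauchy-Schwarz and the Lipschitz bound give \<open>h' <= 0\<close>
    on [0, 1].\<close>
  define h where "h t = f (y + t *\<^sub>R d) - t * (grad y \<bullet> d) - L / 2 * t\<^sup>2 * (norm d)\<^sup>2" for t
  have "h 1 \<le> h 0"
  proof (rule DERIV_nonpos_imp_nonincreasing[of 0 1 h])
    fix t :: real assume t: "0 \<le> t" "t \<le> 1"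
    let ?D = "(grad (y + t *\<^sub>R d) - grad y) \<bullet> d - L * t * (norm d)\<^sup>2"
    have "((\<lambda>t. f (y + t *\<^sub>R d)) has_derivative (\<lambda>s. (s *\<^sub>R d) \<bullet> grad (y + t *\<^sub>R d))) (at t)"
      by (rule has_derivative_compose[where f = "\<lambda>t. y + t *\<^sub>R d"])
        (use gradient[of "y + t *\<^sub>R d"] in \<open>auto simp: gderiv_def intro!: derivative_eq_intros\<close>)
    then have "((\<lambda>t. f (y + t *\<^sub>R d)) has_real_derivative grad (y + t *\<^sub>R d) \<bullet> d) (at t)"
      by (simp add: has_field_derivative_def inner_commute mult.commute[of _ "_ \<bullet> _"])
    then have "(h has_real_derivative ?D) (at t)"
      unfolding h_def by (auto intro!: derivative_eq_intros simp: inner_diff_left)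
    moreover have "?D \<le> 0"
    proof -
      have "(grad (y + t *\<^sub>R d) - grad y) \<bullet> d \<le> norm (grad (y + t *\<^sub>R d) - grad y) * norm d"
        by (rule norm_cauchy_schwarz)
      also have "\<dots> \<le> (L * norm (t *\<^sub>R d)) * norm d"
        using smooth[of "y + t *\<^sub>R d" y] by (intro mult_right_mono) auto
      finally show ?thesis
        using t by (simp add: power2_eq_square mult_ac)
    qed
    ultimately show "\<exists>D. (h has_real_derivative D) (at t) \<and> D \<le> 0"
      by blast
  qed simp
  then show ?thesis
    by (simp add: h_def)
qed

text \<open>Here \<open>c\<close> and \<open>b\<close> are consecutive roots, \<open>u\<close> and
  \<open>v\<close> the values of \<open>f\<close> before and after the step. Doubling the descent
  inequality yields the decrease \<open>(b\<^sup>2 - c\<^sup>2) / b\<close> twice: once to pay for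
  \<open>b - c\<close>, once against the smoothness term. The logarithm covers that term while
  \<open>b < L\<close>.\<close>

lemma adagrad_potential_step:
  fixes b c L M u v :: real
  assumes "0 < c" "c \<le> b" "0 \<le> L" "L \<le> M" "0 < M"
    and descent: "v \<le> u - (b\<^sup>2 - c\<^sup>2) / b + L / 2 * ((b\<^sup>2 - c\<^sup>2) / b\<^sup>2)"
  shows "b + 2 * v - 2 * L * ln (min b M) \<le> c + 2 * u - 2 * L * ln (min c M)"
proof -
  have b: "0 < b" using assms by simp
  define p where "p = (b\<^sup>2 - c\<^sup>2) / b"
  have p0: "0 \<le> p" unfolding p_def using assms b by (simp add: power_mono)
  have bc: "b - c \<le> p"
  proof -
    have "c * c \<le> c * b" using assms by (intro mult_left_mono) auto
    then show ?thesis using b by (simp add: p_def field_simps power2_eq_square)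
  qed
  have quot: "(b\<^sup>2 - c\<^sup>2) / b\<^sup>2 = p / b" by (simp add: p_def power2_eq_square)
  have mono: "ln (min c M) \<le> ln (min b M)" using assms b by (subst ln_le_cancel_iff) auto
  have "- p + L * (p / b) \<le> 2 * L * (ln (min b M) - ln (min c M))"
  proof (cases "L \<le> b")
    case True
    then have "L * p \<le> b * p" using p0 by (rule mult_right_mono)
    then have "L * (p / b) \<le> p" using b by (simp add: field_simps)
    moreover have "0 \<le> 2 * L * (ln (min b M) - ln (min c M))" using mono assms by simp
    ultimately show ?thesis by linarith
  next
    case False
    \<comment> \<open>Since \<open>b < L \<le> M\<close>, the cap is inactive at both roots, and
      \<open>ln q \<le> q - 1\<close> bounds \<open>p / b = 1 - q\<close> by the growth of the
      logarithm.\<close>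
    define q where "q = (c / b)\<^sup>2"
    have "ln q \<le> q - 1" using assms b by (intro ln_le_minus_one) (auto simp: q_def)
    moreover have "ln q = 2 * (ln c - ln b)"
      using assms b by (simp add: q_def ln_realpow ln_div)
    moreover have "p / b = 1 - q"
      unfolding quot[symmetric] q_def using b by (simp add: power_divide diff_divide_distrib)
    ultimately have "p / b \<le> 2 * (ln b - ln c)" by simp
    then have "L * (p / b) \<le> L * (2 * (ln b - ln c))" using assms by (intro mult_left_mono)
    moreover have "min b M = b" "min c M = c" using False assms by auto
    ultimately show ?thesis using p0 by (simp add: algebra_simps)
  qed
  then show ?thesis
    using bc descent unfolding quot p_def[symmetric] by (simp add: algebra_simps)
qed

lemma adagrad_root_bound:
  fixes a F :: "nat \<Rightarrow> real" and L :: real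
  defines "b \<equiv> \<lambda>t. sqrt (\<Sum>k=1..t. (a k)\<^sup>2)"
  assumes a1: "0 < a 1" and L: "0 \<le> L"
    and descent: "\<And>t. 1 \<le> t \<Longrightarrow> F (Suc t) \<le> F t - (a t)\<^sup>2 / b t + L / 2 * ((a t)\<^sup>2 / (b t)\<^sup>2)"
    and T: "1 \<le> T"
  shows "b T \<le> 2 * (F 1 - F (Suc T)) + L * (1 + 2 * ln (max 1 (L / a 1)))"
proof -
  \<comment> \<open>The cap must be at least \<open>L\<close> for the step lemma and at least
    \<open>a 1\<close> so that it is inactive at the start of the telescoping.\<close>
  define M where "M = max L (a 1)"
  have M: "0 < M" "L \<le> M" "a 1 \<le> M" using a1 by (auto simp: M_def)
  have bSuc: "(b (Suc t))\<^sup>2 = (b t)\<^sup>2 + (a (Suc t))\<^sup>2" for t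
    by (simp add: b_def sum_nonneg)
  have b_mono: "b t \<le> b (Suc t)" for t by (simp add: b_def)
  have b1: "b 1 = a 1" using a1 by (simp add: b_def)
  have "a 1 \<le> b T \<and> b T + 2 * F (Suc T) - 2 * L * ln (min (b T) M) \<le> L + 2 * F 1 - 2 * L * ln (a 1)"
    using T
  proof (induction T rule: dec_induct)
    case base
    \<comment> \<open>The previous root would be 0, where the potential has no logarithm. The first
      step is therefore estimated directly, at the cost of one \<open>L\<close>.\<close>
    have "L * (a 1)\<^sup>2 / (a 1)\<^sup>2 = L" "(a 1)\<^sup>2 / a 1 = a 1"
      using a1 by (auto simp: power2_eq_square)
    then have "a 1 + 2 * F (Suc 1) \<le> L + 2 * F 1"
      using descent[of 1] a1 unfolding b1 by simp
    then show ?case using b1 M by simp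
  next
    case (step t)
    have "F (Suc (Suc t)) \<le> F (Suc t) - ((b (Suc t))\<^sup>2 - (b t)\<^sup>2) / b (Suc t)
        + L / 2 * (((b (Suc t))\<^sup>2 - (b t)\<^sup>2) / (b (Suc t))\<^sup>2)"
      using descent[of "Suc t"] by (simp only: bSuc) simp
    from adagrad_potential_step[OF _ b_mono L M(2,1) this]
    show ?case using step.IH a1 b_mono[of t] by linarith
  qed
  then have bT: "a 1 \<le> b T"
    and pot: "b T + 2 * F (Suc T) - 2 * L * ln (min (b T) M) \<le> L + 2 * F 1 - 2 * L * ln (a 1)"
    by auto
  have "L * ln (min (b T) M) \<le> L * ln M"
    using L M bT a1 by (intro mult_left_mono) auto
  moreover have "ln (max 1 (L / a 1)) = ln M - ln (a 1)"
  proof -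
    have "max 1 (L / a 1) = M / a 1" using a1 by (auto simp: M_def max_def field_simps)
    then show ?thesis using M a1 by (simp add: ln_div)
  qed
  ultimately show ?thesis using pot by (simp add: distrib_left right_diff_distrib)
qed

text \<open>The descent lemma along the AdaGrad step. It includes \<open>b = 0\<close>: then the
  step and both quotients are 0.\<close>

lemma adagrad_descent:
  fixes f :: "'a::real_inner \<Rightarrow> real"
  assumes gradient: "\<And>y. GDERIV f y :> grad y"
    and smooth: "\<And>y z. norm (grad y - grad z) \<le> L * norm (y - z)"
    and adagrad: "adagrad_iterates 0 grad x"
    and t: "1 \<le> t"
  defines "b \<equiv> sqrt (\<Sum>k=1..t. (norm (grad (x k)))\<^sup>2)"
  shows "f (x (Suc t)) \<le> f (x t) - (norm (grad (x t)))\<^sup>2 / b + L / 2 * ((norm (grad (x t)))\<^sup>2 / b\<^sup>2)"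
proof -
  have "x (Suc t) = x t + (- (1 / b)) *\<^sub>R grad (x t)"
    using adagrad t by (simp add: adagrad_iterates_def adagrad_stepsize_def b_def)
  then have "f (x (Suc t)) \<le> f (x t) + grad (x t) \<bullet> ((- (1 / b)) *\<^sub>R grad (x t))
      + L / 2 * (norm ((- (1 / b)) *\<^sub>R grad (x t)))\<^sup>2"
    using smooth_descent[OF gradient smooth] by metis
  then show ?thesis
    by (simp add: power_mult_distrib power_divide dot_square_norm)
qed

lemma adagrad_stationary:
  assumes adagrad: "adagrad_iterates G0 grad x" and "grad (x 1) = 0" and "1 \<le> t"
  shows "x t = x 1"
  using \<open>1 \<le> t\<close>
proof (induction t rule: dec_induct)
  case (step t)
  then show ?case using adagrad \<open>grad (x 1) = 0\<close> by (simp add: adagrad_iterates_def)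
qed simp

lemma adagrad_sum_bound:
  fixes f :: "'a::real_inner \<Rightarrow> real"
  assumes gradient: "\<And>y. GDERIV f y :> grad y"
    and smooth: "\<And>y z. norm (grad y - grad z) \<le> L * norm (y - z)"
    and minimum: "\<And>y. f xmin \<le> f y"
    and adagrad: "adagrad_iterates 0 grad x"
    and T: "1 \<le> T"
  shows "(\<Sum>t=1..T. (norm (grad (x t)))\<^sup>2)
    \<le> rate_constant (L / norm (grad (x 1))) * (f (x 1) - f xmin + L)\<^sup>2"
proof (cases "grad (x 1) = 0")
  case True
  \<comment> \<open>The root bound requires a positive first norm. In this case the iterates never
    move, and the sum is 0.\<close>
  have "grad (x t) = 0" if "1 \<le> t" for t
    using adagrad_stationary[OF adagrad True that] True by metis
  then have "(\<Sum>t=1..T. (norm (grad (x t)))\<^sup>2) = 0"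
    by (intro sum.neutral) auto
  then show ?thesis by (simp add: rate_constant_def)
next
  case False
  have L: "0 \<le> L"
  proof -
    \<comment> \<open>The sign of \<open>L\<close> follows from smoothness at two distinct points;
      the nonzero gradient itself serves as one, the origin as the other.\<close>
    let ?d = "grad (x 1)"
    have "0 \<le> L * norm (?d - 0)" using smooth[of ?d 0] norm_ge_zero order_trans by blast
    then show ?thesis using False by (simp add: zero_le_mult_iff)
  qed
  define l where "l = ln (max 1 (L / norm (grad (x 1))))"
  define \<Delta> where "\<Delta> = f (x 1) - f xmin"
  define S where "S = (\<Sum>t=1..T. (norm (grad (x t)))\<^sup>2)"
  have l: "0 \<le> l" by (simp add: l_def)
  have \<Delta>: "0 \<le> \<Delta>" using minimum by (simp add: \<Delta>_def)
  have S: "0 \<le> S" by (simp add: S_def sum_nonneg)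
  have "sqrt S \<le> 2 * (f (x 1) - f (x (Suc T))) + L * (1 + 2 * l)"
    unfolding S_def l_def
    using False L T adagrad_descent[OF gradient smooth adagrad]
    by (intro adagrad_root_bound[where F = "\<lambda>t. f (x t)" and a = "\<lambda>t. norm (grad (x t))"]) auto
  also have "\<dots> \<le> 2 * \<Delta> + L * (1 + 2 * l)"
    using minimum[of "x (Suc T)"] by (simp add: \<Delta>_def)
  \<comment> \<open>Adding \<open>L + 2 * l * \<Delta>\<close> makes the bound a product, whose
    square has the factor \<open>rate_constant\<close>.\<close>
  also have "\<dots> \<le> 2 * (1 + l) * (\<Delta> + L)"
    using L \<Delta> l by (simp add: algebra_simps)
  finally have "(sqrt S)\<^sup>2 \<le> (2 * (1 + l) * (\<Delta> + L))\<^sup>2"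
    using S by (intro power_mono) auto
  then show ?thesis
    unfolding rate_constant_def l_def[symmetric] \<Delta>_def[symmetric] S_def[symmetric]
    using S by (simp only: power_mult_distrib real_sqrt_pow2) simp
qed

text \<open>The constant in \<open>O\<close> may depend on \<open>f\<close>, \<open>L\<close> and
  the trajectory. The second conjunct makes it explicit, as a function of
  \<open>L / norm (grad (x 1))\<close> alone, for every \<open>T \<ge> 1\<close>.\<close>

theorem theorem4p1:
  fixes f :: "real ^ 'd \<Rightarrow> real"
    and grad :: "real ^ 'd \<Rightarrow> real ^ 'd"
    and x :: "nat \<Rightarrow> real ^ 'd"
    and xmin :: "real ^ 'd"
    and L \<Delta>\<^sub>1 :: real
  assumes gradient: "\<And>y. GDERIV f y :> grad y"
    and smooth: "\<And>y z. norm (grad y - grad z) \<le> L * norm (y - z)"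
    and minimum: "\<And>y. f xmin \<le> f y"
    and adagrad: "adagrad_iterates 0 grad x"
    and Delta: "\<Delta>\<^sub>1 = f (x 1) - f xmin"
  shows "(\<lambda>T::nat. 1 / real T * (\<Sum>t=1..T. (norm (grad (x t)))\<^sup>2)) \<in> O(\<lambda>T. (\<Delta>\<^sub>1 + L)\<^sup>2 / real T)
       \<and> (\<forall>T\<ge>1. 1 / real T * (\<Sum>t=1..T. (norm (grad (x t)))\<^sup>2)
                  \<le> rate_constant (L / norm (grad (x 1))) * ((\<Delta>\<^sub>1 + L)\<^sup>2 / real T))"
proof -
  have bound: "1 / real T * (\<Sum>t=1..T. (norm (grad (x t)))\<^sup>2)
      \<le> rate_constant (L / norm (grad (x 1))) * ((\<Delta>\<^sub>1 + L)\<^sup>2 / real T)" if "1 \<le> T" for T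
    using divide_right_mono[OF adagrad_sum_bound[OF gradient smooth minimum adagrad that], of "real T"]
    by (simp add: Delta)
  have "(\<lambda>T::nat. 1 / real T * (\<Sum>t=1..T. (norm (grad (x t)))\<^sup>2)) \<in> O(\<lambda>T. (\<Delta>\<^sub>1 + L)\<^sup>2 / real T)"
  proof (rule bigoI)
    show "\<forall>\<^sub>F T in sequentially. norm (1 / real T * (\<Sum>t=1..T. (norm (grad (x t)))\<^sup>2))
        \<le> rate_constant (L / norm (grad (x 1))) * norm ((\<Delta>\<^sub>1 + L)\<^sup>2 / real T)"
      using eventually_ge_at_top[of 1]
    proof eventually_elim
      case (elim T)
      have "0 \<le> (\<Sum>t=1..T. (norm (grad (x t)))\<^sup>2)" by (simp add: sum_nonneg)
      then show ?case using bound[OF elim] by simp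
    qed
  qed
  with bound show ?thesis by blast
qed

end
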